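(* Let $(V,\sigma)$ be a free symplectic $\widetilde{\mathbb R}$-module of finite rank $2n$. Let $I,J\subseteq\{1,\dots,n\}$ and let $e_i\in V$ ($i\in I$) and $f_j\in V$ ($j\in J$) be elements such that the set $B:=\{e_i\mid i\in I\}\cup\{f_j\mid j\in J\}$ is free (linearly independent over $\widetilde{\mathbb R}$) in $V$ and satisfies $$\sigma(e_i,e_k)=0=\sigma(f_j,f_l),\qquad \sigma(f_j,e_i)=\delta_{ji}\qquad(i,k\in I;\ j,l\in J).$$ Then one can find elements $e_i\in V$ ($i\in\{1,\dots,n\}\setminus I$) and $f_j\in V$ ($j\in\{1,\dots,n\}\setminus J$) such that $\{e_1,\dots,e_n,f_1,\dots,f_n\}$ is a symplectic basis of $(V,\sigma)$.
   Context: The ring of Colombeau generalized real numbers is $\widetilde{\mathbb R}=\mathcal E_M/\mathcal N$, where $\mathcal E_M=\{(r_\varepsilon)_{\varepsilon\in(0,1]}\in\mathbb R^{(0,1]}:\exists N\in\mathbb N,\ |r_\varepsilon|=O(\varepsilon^{-N})\ (\varepsilon\to0)\}$ and $\mathcal N=\{(r_\varepsilon)_{\varepsilon\in(0,1]}\in\mathbb R^{(0,1]}:\forall m\in\mathbb N,\ |r_\varepsilon|=O(\varepsilon^{m})\ (\varepsilon\to0)\}$, with operations defined componentwise on representatives; it is a commutative ring with unit. Let $V$ be an $\widetilde{\mathbb R}$-module. An $\widetilde{\mathbb R}$-bilinear form $\sigma:V\times V\to\widetilde{\mathbb R}$ is a symplectic form on $V$ if it is skew-symmetric ($\sigma(v,w)=-\sigma(w,v)$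 for all $v,w\in V$) and non-degenerate (if $w\in V$ satisfies $\sigma(v,w)=0$ for all $v\in V$, then $w=0$). The pair $(V,\sigma)$ is then called a symplectic $\widetilde{\mathbb R}$-module; it is called free (of finite rank) if $V$ is. A symplectic basis of a free symplectic $\widetilde{\mathbb R}$-module $(V,\sigma)$ of rank $2n$ is a basis $\{e_1,\dots,e_n,f_1,\dots,f_n\}$ of $V$ with $\sigma(e_j,e_l)=0=\sigma(f_j,f_l)$ and $\sigma(f_j,e_l)=\delta_{jl}$ for $1\le j,l\le n$. *)

theory Defs
  imports Complex_Main "HOL-Library.Landau_Symbols"
begin

text \<open>
  A net indexed by \<open>(0, 1]\<close> is represented by a function on all of \<open>real\<close>. Both conditions below
  only depend on the values at arguments tending to 0 from the right, so that the
  values outside \<open>(0, 1]\<close> disappear in the quotient.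
\<close>

definition moderate :: "(real \<Rightarrow> real) \<Rightarrow> bool" where
  "moderate r \<longleftrightarrow> (\<exists>N::nat. r \<in> O[at_right 0](\<lambda>\<epsilon>. inverse (\<epsilon> ^ N)))"

definition negligible_net :: "(real \<Rightarrow> real) \<Rightarrow> bool" where
  "negligible_net r \<longleftrightarrow> (\<forall>m::nat. r \<in> O[at_right 0](\<lambda>\<epsilon>. \<epsilon> ^ m))"

lemma inverse_power_bigo:
  assumes "M \<le> N"
  shows "(\<lambda>\<epsilon>::real. inverse (\<epsilon> ^ M)) \<in> O[at_right 0](\<lambda>\<epsilon>. inverse (\<epsilon> ^ N))"
proof (rule landau_o.bigI[of 1])
  have "\<forall>\<^sub>F x in at_right (0::real). 0 < x \<and> x < 1"
    using eventually_at_right_real[of 0 1] by simp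
  then show "\<forall>\<^sub>F x in at_right 0. norm (inverse (x ^ M)) \<le> 1 * norm (inverse (x ^ N) :: real)"
    by eventually_elim (use assms in \<open>simp add: power_decreasing le_imp_inverse_le\<close>)
qed simp

lemma moderate_const: "moderate (\<lambda>_. c)"
  unfolding moderate_def by (intro exI[of _ 0]) simp

lemma moderate_uminus: "moderate r \<Longrightarrow> moderate (\<lambda>\<epsilon>. - r \<epsilon>)"
  unfolding moderate_def by simp

lemma moderate_add:
  assumes "moderate r" "moderate s"
  shows "moderate (\<lambda>\<epsilon>. r \<epsilon> + s \<epsilon>)"
proof -
  obtain M N :: nat where "r \<in> O[at_right 0](\<lambda>\<epsilon>. inverse (\<epsilon> ^ M))"
    and "s \<in> O[at_right 0](\<lambda>\<epsilon>. inverse (\<epsilon> ^ N))"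
    using assms unfolding moderate_def by blast
  then have "r \<in> O[at_right 0](\<lambda>\<epsilon>. inverse (\<epsilon> ^ max M N))"
    and "s \<in> O[at_right 0](\<lambda>\<epsilon>. inverse (\<epsilon> ^ max M N))"
    using inverse_power_bigo[of M "max M N"] inverse_power_bigo[of N "max M N"]
    by (auto intro: landau_o.big_trans)
  then show ?thesis
    unfolding moderate_def by (blast intro: sum_in_bigo)
qed

lemma moderate_mult:
  assumes "moderate r" "moderate s"
  shows "moderate (\<lambda>\<epsilon>. r \<epsilon> * s \<epsilon>)"
proof -
  obtain M N :: nat where "r \<in> O[at_right 0](\<lambda>\<epsilon>. inverse (\<epsilon> ^ M))"
    and "s \<in> O[at_right 0](\<lambda>\<epsilon>. inverse (\<epsilon> ^ N))"
    using assms unfolding moderate_def by blast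
  from landau_o.big.mult[OF this]
  have "(\<lambda>\<epsilon>. r \<epsilon> * s \<epsilon>) \<in> O[at_right 0](\<lambda>\<epsilon>. inverse (\<epsilon> ^ (M + N)))"
    by (simp add: power_add)
  then show ?thesis
    unfolding moderate_def by blast
qed

lemma negligible_zero: "negligible_net (\<lambda>_. 0)"
  unfolding negligible_net_def by simp

lemma negligible_uminus: "negligible_net r \<Longrightarrow> negligible_net (\<lambda>\<epsilon>. - r \<epsilon>)"
  unfolding negligible_net_def by simp

lemma negligible_add:
  "negligible_net r \<Longrightarrow> negligible_net s \<Longrightarrow> negligible_net (\<lambda>\<epsilon>. r \<epsilon> + s \<epsilon>)"
  unfolding negligible_net_def by (blast intro: sum_in_bigo)

lemma negligible_mult:
  assumes "moderate r" "negligible_net s"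
  shows "negligible_net (\<lambda>\<epsilon>. r \<epsilon> * s \<epsilon>)"
  unfolding negligible_net_def
proof
  fix m :: nat
  obtain N :: nat where "r \<in> O[at_right 0](\<lambda>\<epsilon>. inverse (\<epsilon> ^ N))"
    using assms(1) unfolding moderate_def by blast
  moreover have "s \<in> O[at_right 0](\<lambda>\<epsilon>. \<epsilon> ^ (N + m))"
    using assms(2) unfolding negligible_net_def by blast
  ultimately have "(\<lambda>\<epsilon>. r \<epsilon> * s \<epsilon>) \<in> O[at_right 0](\<lambda>\<epsilon>. inverse (\<epsilon> ^ N) * \<epsilon> ^ (N + m))"
    by (rule landau_o.big.mult)
  also have "(\<lambda>\<epsilon>::real. inverse (\<epsilon> ^ N) * \<epsilon> ^ (N + m)) \<in> \<Theta>[at_right 0](\<lambda>\<epsilon>. \<epsilon> ^ m)"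
  proof (rule bigthetaI_cong)
    show "\<forall>\<^sub>F \<epsilon> in at_right 0. inverse (\<epsilon> ^ N) * \<epsilon> ^ (N + m) = (\<epsilon> ^ m :: real)"
      using eventually_at_right_less[of "0::real"] by eventually_elim (simp add: power_add)
  qed
  finally show "(\<lambda>\<epsilon>. r \<epsilon> * s \<epsilon>) \<in> O[at_right 0](\<lambda>\<epsilon>. \<epsilon> ^ m)" .
qed

definition net_rel :: "(real \<Rightarrow> real) \<Rightarrow> (real \<Rightarrow> real) \<Rightarrow> bool" where
  "net_rel r s \<longleftrightarrow> moderate r \<and> moderate s \<and> negligible_net (\<lambda>\<epsilon>. r \<epsilon> - s \<epsilon>)"

lemma net_rel_refl: "moderate r \<Longrightarrow> net_rel r r"
  by (simp add: net_rel_def negligible_zero)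

quotient_type gen_real = "real \<Rightarrow> real" / partial: net_rel
proof (rule part_equivpI)
  show "\<exists>r. net_rel r r"
    using moderate_const net_rel_refl by blast
  show "symp net_rel"
  proof (rule sympI)
    fix r s assume "net_rel r s"
    then show "net_rel s r"
      using negligible_uminus[of "\<lambda>\<epsilon>. r \<epsilon> - s \<epsilon>"] by (simp add: net_rel_def)
  qed
  show "transp net_rel"
  proof (rule transpI)
    fix r s t assume "net_rel r s" "net_rel s t"
    then show "net_rel r t"
      using negligible_add[of "\<lambda>\<epsilon>. r \<epsilon> - s \<epsilon>" "\<lambda>\<epsilon>. s \<epsilon> - t \<epsilon>"] by (simp add: net_rel_def)
  qed
qed

instantiation gen_real :: comm_ring_1
begin

lift_definition zero_gen_real :: gen_real is "\<lambda>_. 0"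
  by (rule net_rel_refl[OF moderate_const])

lift_definition one_gen_real :: gen_real is "\<lambda>_. 1"
  by (rule net_rel_refl[OF moderate_const])

lift_definition uminus_gen_real :: "gen_real \<Rightarrow> gen_real" is "\<lambda>r \<epsilon>. - r \<epsilon>"
proof -
  fix r s assume "net_rel r s"
  then show "net_rel (\<lambda>\<epsilon>. - r \<epsilon>) (\<lambda>\<epsilon>. - s \<epsilon>)"
    using negligible_uminus[of "\<lambda>\<epsilon>. r \<epsilon> - s \<epsilon>"] by (simp add: net_rel_def moderate_uminus)
qed

lift_definition plus_gen_real :: "gen_real \<Rightarrow> gen_real \<Rightarrow> gen_real" is "\<lambda>r s \<epsilon>. r \<epsilon> + s \<epsilon>"
proof -
  fix r r' s s' assume "net_rel r r'" "net_rel s s'"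
  then show "net_rel (\<lambda>\<epsilon>. r \<epsilon> + s \<epsilon>) (\<lambda>\<epsilon>. r' \<epsilon> + s' \<epsilon>)"
    using negligible_add[of "\<lambda>\<epsilon>. r \<epsilon> - r' \<epsilon>" "\<lambda>\<epsilon>. s \<epsilon> - s' \<epsilon>"]
    by (simp add: net_rel_def moderate_add algebra_simps)
qed

lift_definition times_gen_real :: "gen_real \<Rightarrow> gen_real \<Rightarrow> gen_real" is "\<lambda>r s \<epsilon>. r \<epsilon> * s \<epsilon>"
proof -
  fix r r' s s' assume *: "net_rel r r'" "net_rel s s'"
  have "negligible_net (\<lambda>\<epsilon>. r \<epsilon> * (s \<epsilon> - s' \<epsilon>) + s' \<epsilon> * (r \<epsilon> - r' \<epsilon>))"
    using * by (intro negligible_add negligible_mult) (simp_all add: net_rel_def)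
  then show "net_rel (\<lambda>\<epsilon>. r \<epsilon> * s \<epsilon>) (\<lambda>\<epsilon>. r' \<epsilon> * s' \<epsilon>)"
    using * by (simp add: net_rel_def moderate_mult algebra_simps)
qed

definition minus_gen_real :: "gen_real \<Rightarrow> gen_real \<Rightarrow> gen_real" where
  "minus_gen_real x y = x + (- y)"

instance
proof
  fix a b c :: gen_real
  show "a + b + c = a + (b + c)"
    by transfer (simp add: net_rel_def moderate_add negligible_zero add.assoc)
  show "a + b = b + a"
    by transfer (simp add: net_rel_def moderate_add negligible_zero)
  show "0 + a = a"
    by transfer (simp add: net_rel_def negligible_zero)
  show "- a + a = 0"
    by transfer (simp add: net_rel_def negligible_zero moderate_const)
  show "a - b = a + - b"
    by (rule minus_gen_real_def)
  show "a * b * c = a * (b * c)"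
    by transfer (simp add: net_rel_def moderate_mult negligible_zero mult.assoc)
  show "a * b = b * a"
    by transfer (simp add: net_rel_def moderate_mult negligible_zero mult.commute)
  show "1 * a = a"
    by transfer (simp add: net_rel_def negligible_zero)
  show "(a + b) * c = a * c + b * c"
    by transfer (simp add: net_rel_def moderate_mult moderate_add negligible_zero algebra_simps)
  show "(0::gen_real) \<noteq> 1"
  proof transfer
    have "\<not> negligible_net (\<lambda>\<epsilon>. 0 - 1)"
    proof
      assume "negligible_net (\<lambda>\<epsilon>. 0 - 1)"
      then have "(\<lambda>\<epsilon>::real. - 1 :: real) \<in> O[at_right 0](\<lambda>\<epsilon>. \<epsilon> ^ 1)"
        unfolding negligible_net_def diff_0 by blast
      then obtain c where c: "c > 0" "\<forall>\<^sub>F x in at_right 0. norm (- 1 :: real) \<le> c * norm (x ^ 1 :: real)"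
        by (elim landau_o.bigE)
      have "\<forall>\<^sub>F x in at_right (0::real). x \<in> {0<..<1/c}"
        using c(1) by (intro eventually_at_right_real) simp
      with c(2) have "\<forall>\<^sub>F x in at_right (0::real). False"
        by eventually_elim (use c(1) in \<open>simp add: field_simps\<close>)
      then show False
        by (simp add: trivial_limit_at_right_real)
    qed
    then show "\<not> net_rel (\<lambda>_. 0) (\<lambda>_. 1)"
      by (simp add: net_rel_def)
  qed
qed

end

text \<open>
  The library notion \<open>independent\<close> is about sets. A family with a repeated member is not
  linearly independent even if the set of its members is, hence the injectivity.
\<close>

definition (in module) free_family :: "'i set \<Rightarrow> ('i \<Rightarrow> 'b) \<Rightarrow> bool" where
  "free_family A x \<longleftrightarrow> inj_on x A \<and> independent (x ` A)"

definition (in module) free_of_rank :: "nat \<Rightarrow> bool" where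
  "free_of_rank m \<longleftrightarrow> (\<exists>B. finite B \<and> card B = m \<and> independent B \<and> span B = UNIV)"

locale symplectic_module = module scale
  for scale :: "gen_real \<Rightarrow> 'v::ab_group_add \<Rightarrow> 'v" +
  fixes \<sigma> :: "'v \<Rightarrow> 'v \<Rightarrow> gen_real"
  assumes linear_left: "module_hom scale (*) (\<lambda>v. \<sigma> v w)"
    and linear_right: "module_hom scale (*) (\<lambda>w. \<sigma> v w)"
    and skew_symmetric: "\<sigma> v w = - \<sigma> w v"
    and non_degenerate: "(\<And>v. \<sigma> v w = 0) \<Longrightarrow> w = 0"
begin

text \<open>
  The relations \<open>\<sigma>(e\<^sub>i, e\<^sub>k) = 0 = \<sigma>(f\<^sub>j, f\<^sub>l)\<close>, \<open>\<sigma>(f\<^sub>j, e\<^sub>i) = \<delta>\<^sub>j\<^sub>i\<close> for \<open>i, k \<in> I\<close> and \<open>j, l \<in> J\<close>.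
\<close>

definition symplectic_relations ::
    "nat set \<Rightarrow> nat set \<Rightarrow> (nat \<Rightarrow> 'v) \<Rightarrow> (nat \<Rightarrow> 'v) \<Rightarrow> bool" where
  "symplectic_relations I J e f \<longleftrightarrow>
     (\<forall>i\<in>I. \<forall>k\<in>I. \<sigma> (e i) (e k) = 0) \<and>
     (\<forall>j\<in>J. \<forall>l\<in>J. \<sigma> (f j) (f l) = 0) \<and>
     (\<forall>j\<in>J. \<forall>i\<in>I. \<sigma> (f j) (e i) = (if j = i then 1 else 0))"

definition symplectic_basis :: "nat \<Rightarrow> (nat \<Rightarrow> 'v) \<Rightarrow> (nat \<Rightarrow> 'v) \<Rightarrow> bool" where
  "symplectic_basis n e f \<longleftrightarrow>
     free_family ({1..n} <+> {1..n}) (case_sum e f) \<and>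
     span (e ` {1..n} \<union> f ` {1..n}) = UNIV \<and>
     symplectic_relations {1..n} {1..n} e f"

end

end

theory Submission
  imports "Jordan_Normal_Form.Determinant" Defs
begin

text \<open>
  For a finite family in the ring of generalized numbers without common annihilator, choosing for
  every \<open>\<epsilon>\<close> a member of maximal absolute value yields orthogonal idempotents \<open>c i\<close>
  such that \<open>\<Sum>i. c i * a i\<close> is a unit. Applied to the numbers \<open>\<sigma> b x\<close>, where \<open>b\<close> runs
  through a basis, this gives \<open>w\<close> with \<open>\<sigma> w x = 1\<close> for every free vector \<open>x\<close>, and then, as in
  the Gram-Schmidt process, a dual family for every finite free family. The member of the dual
  family that belongs to \<open>e i\<close> can serve as a missing \<open>f i\<close>, and similarly for a missing \<open>e j\<close>.
  Once \<open>I = J\<close>, a free vector in the orthogonal complement of the pairs found so far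
  provides a new \<open>e j\<close>. Finally, \<open>2 * n\<close> vectors with a dual family span a
  free module of rank \<open>2 * n\<close>, because a one-sided inverse of a square matrix is two-sided.
\<close>

section \<open>Generalized numbers\<close>

lemma abs_gen_real_eq_iff:
  assumes "moderate r" "moderate s"
  shows "abs_gen_real r = abs_gen_real s \<longleftrightarrow> negligible_net (\<lambda>\<epsilon>. r \<epsilon> - s \<epsilon>)"
  using Quotient_rel[OF Quotient_gen_real, of r s] assms net_rel_refl
  by (auto simp: net_rel_def)

lemma abs_gen_real_mult:
  "moderate r \<Longrightarrow> moderate s \<Longrightarrow> abs_gen_real r * abs_gen_real s = abs_gen_real (\<lambda>\<epsilon>. r \<epsilon> * s \<epsilon>)"
  by (simp add: times_gen_real.abs_eq net_rel_refl)

lemma abs_gen_real_sum: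
  assumes "finite A" and "\<And>i. i \<in> A \<Longrightarrow> moderate (r i)"
  shows "moderate (\<lambda>\<epsilon>. \<Sum>i\<in>A. r i \<epsilon>) \<and>
    (\<Sum>i\<in>A. abs_gen_real (r i)) = abs_gen_real (\<lambda>\<epsilon>. \<Sum>i\<in>A. r i \<epsilon>)"
  using assms
proof (induction A rule: finite_induct)
  case empty
  then show ?case
    by (simp add: moderate_const zero_gen_real_def)
next
  case (insert i A)
  then show ?case
    by (simp add: moderate_add plus_gen_real.abs_eq net_rel_refl)
qed

lemma gen_real_representative:
  obtains r where "moderate r" "abs_gen_real r = x"
proof -
  have "net_rel (rep_gen_real x) (rep_gen_real x)" "abs_gen_real (rep_gen_real x) = x"
    using Quotient_rep_reflp[OF Quotient_gen_real] Quotient_abs_rep[OF Quotient_gen_real] by auto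
  then show thesis
    by (intro that) (auto simp: net_rel_def)
qed

lemma moderate_indicator: "moderate (\<lambda>\<epsilon>. if P \<epsilon> then 1 else 0)"
  unfolding moderate_def by (intro exI[of _ 0] landau_o.bigI[of 1]) (auto intro!: always_eventually)

lemma of_nat_gen_real: "of_nat d = abs_gen_real (\<lambda>_. of_nat d)"
proof (induction d)
  case 0
  then show ?case
    by (simp add: zero_gen_real_def)
next
  case (Suc d)
  then show ?case
    by (simp add: one_gen_real_def plus_gen_real.abs_eq net_rel_refl moderate_const)
qed

text \<open>The class of the constant net \<open>1 / d\<close> is an inverse of \<open>d\<close>,
  although the ring has zero divisors.\<close>

lemma of_nat_mult_gen_real_eq_0:
  fixes x :: gen_real
  assumes "of_nat d * x = 0" "d > 0"
  shows "x = 0"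
proof -
  have "of_nat d * abs_gen_real (\<lambda>_. 1 / of_nat d) = 1"
    using assms(2) by (simp add: of_nat_gen_real abs_gen_real_mult moderate_const one_gen_real_def)
  then have "x = abs_gen_real (\<lambda>_. 1 / of_nat d) * (of_nat d * x)"
    by (metis mult.assoc mult.commute mult_1)
  then show ?thesis
    using assms(1) by simp
qed

text \<open>
  A moderate net without a lower bound \<open>\<epsilon> ^ N\<close> is smaller than \<open>\<epsilon> ^ k\<close> along some
  sequence \<open>E k\<close> tending to 0. The indicator of that sequence is a nonzero generalized number
  that annihilates every net dominated by the given one.
\<close>

lemma annihilator_of_small_net:
  assumes small: "\<And>N::nat. \<not> (\<forall>\<^sub>F \<epsilon> in at_right 0. \<epsilon> ^ N \<le> \<bar>m \<epsilon>\<bar>)"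
  obtains s where "s \<noteq> 0"
    and "\<And>r. moderate r \<Longrightarrow> (\<And>\<epsilon>. \<bar>r \<epsilon>\<bar> \<le> \<bar>m \<epsilon>\<bar>) \<Longrightarrow> s * abs_gen_real r = 0"
proof -
  \<comment> \<open>The bound \<open>1 / Suc k\<close> makes the chosen points tend to 0; the
    growing exponent makes \<open>m\<close> smaller than every fixed power along them.\<close>
  have "\<exists>\<epsilon>. 0 < \<epsilon> \<and> \<epsilon> < 1 / Suc k \<and> \<bar>m \<epsilon>\<bar> < \<epsilon> ^ k" for k
  proof (rule ccontr)
    assume "\<not> ?thesis"
    then have *: "\<epsilon> ^ k \<le> \<bar>m \<epsilon>\<bar>" if "\<epsilon> \<in> {0<..<1 / Suc k}" for \<epsilon>
      using that by force
    have "\<forall>\<^sub>F \<epsilon> in at_right (0::real). \<epsilon> \<in> {0<..<1 / Suc k}"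
      by (rule eventually_at_right_real) simp
    then have "\<forall>\<^sub>F \<epsilon> in at_right 0. \<epsilon> ^ k \<le> \<bar>m \<epsilon>\<bar>"
      by eventually_elim (rule *)
    with small show False
      by blast
  qed
  then obtain E where E: "\<And>k. 0 < E k" "\<And>k. E k < 1 / Suc k" "\<And>k. \<bar>m (E k)\<bar> < E k ^ k"
    by metis
  define \<chi> :: "real \<Rightarrow> real" where "\<chi> = (\<lambda>\<epsilon>. if \<epsilon> \<in> range E then 1 else 0)"
  have mod: "moderate \<chi>"
    unfolding \<chi>_def by (rule moderate_indicator)
  show thesis
  proof (rule that[of "abs_gen_real \<chi>"])
    show "abs_gen_real \<chi> \<noteq> 0"
    proof
      assume "abs_gen_real \<chi> = 0"
      then have "negligible_net \<chi>"
        using abs_gen_real_eq_iff[OF mod moderate_const[of 0]] by (simp add: zero_gen_real_def)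
      then have "\<chi> \<in> O[at_right 0](\<lambda>\<epsilon>. \<epsilon> ^ 1)"
        unfolding negligible_net_def by blast
      then obtain C where C: "C > 0" "\<forall>\<^sub>F \<epsilon> in at_right 0. norm (\<chi> \<epsilon>) \<le> C * norm (\<epsilon> ^ 1)"
        by (elim landau_o.bigE)
      have "\<forall>\<^sub>F \<epsilon> in at_right (0::real). \<epsilon> \<in> {0<..<1 / C}"
        using C(1) by (intro eventually_at_right_real) simp
      with C(2) have "\<forall>\<^sub>F \<epsilon> in at_right 0. \<epsilon> \<notin> range E"
      proof eventually_elim
        case (elim \<epsilon>)
        then have "norm (\<chi> \<epsilon>) < 1"
          using C(1) by (simp add: field_simps)
        then show ?case
          by (auto simp: \<chi>_def split: if_splits)
      qed
      then obtain d where d: "d > 0" "\<And>\<epsilon>. 0 < \<epsilon> \<Longrightarrow> \<epsilon> < d \<Longrightarrow> \<epsilon> \<notin> range E"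
        unfolding eventually_at_right_field by auto
      obtain k where "inverse (of_nat (Suc k)) < d"
        using reals_Archimedean[OF d(1)] by blast
      then have "E k < d"
        using E(2)[of k] by (simp add: inverse_eq_divide)
      with d(2) E(1) show False
        by blast
    qed
  next
    fix r assume r: "moderate r" "\<And>\<epsilon>. \<bar>r \<epsilon>\<bar> \<le> \<bar>m \<epsilon>\<bar>"
    have "negligible_net (\<lambda>\<epsilon>. \<chi> \<epsilon> * r \<epsilon>)"
      unfolding negligible_net_def
    proof
      fix M :: nat
      \<comment> \<open>Below \<open>d\<close>, a point of \<open>range E\<close> can only be some
        \<open>E k\<close> with \<open>M \<le> k\<close>. The inserted 1 ensures that powers
        decrease as the exponent grows.\<close>
      define d where "d = Min (insert 1 (E ` {..M}))"
      have "d > 0"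
        using E(1) by (simp add: d_def)
      then have "\<forall>\<^sub>F \<epsilon> in at_right (0::real). \<epsilon> \<in> {0<..<d}"
        by (rule eventually_at_right_real)
      then have "\<forall>\<^sub>F \<epsilon> in at_right 0. norm (\<chi> \<epsilon> * r \<epsilon>) \<le> 1 * norm (\<epsilon> ^ M)"
      proof eventually_elim
        case (elim \<epsilon>)
        show ?case
        proof (cases "\<epsilon> \<in> range E")
          case True
          then obtain k where k: "\<epsilon> = E k"
            by blast
          have "\<epsilon> < E j" if "j \<le> M" for j
          proof -
            have "d \<le> E j"
              unfolding d_def using that by (intro Min_le) auto
            then show ?thesis
              using elim by auto
          qed
          then have "M \<le> k"
            using k by (meson less_irrefl nat_le_linear)
          have "d \<le> 1"
            by (simp add: d_def)
          have "\<bar>r \<epsilon>\<bar> \<le> \<epsilon> ^ k"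
            using r(2)[of \<epsilon>] E(3)[of k] k by simp
          also have "\<dots> \<le> \<epsilon> ^ M"
            using elim \<open>d \<le> 1\<close> \<open>M \<le> k\<close> by (intro power_decreasing) auto
          finally show ?thesis
            using True by (simp add: \<chi>_def)
        qed (simp add: \<chi>_def)
      qed
      then show "(\<lambda>\<epsilon>. \<chi> \<epsilon> * r \<epsilon>) \<in> O[at_right 0](\<lambda>\<epsilon>. \<epsilon> ^ M)"
        by (intro landau_o.bigI[of 1]) auto
    qed
    then show "abs_gen_real \<chi> * abs_gen_real r = 0"
      using mod r(1) abs_gen_real_eq_iff[OF moderate_mult[OF mod r(1)] moderate_const[of 0]]
      by (simp add: abs_gen_real_mult zero_gen_real_def)
  qed
qed

text \<open>
  The idempotents \<open>c i\<close> select, for each \<open>\<epsilon>\<close>, an index \<open>i\<close> at which \<open>\<bar>a i\<bar>\<close> is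
  maximal.
\<close>

lemma orthogonal_idempotents_unit:
  fixes a :: "'i \<Rightarrow> gen_real"
  assumes fin: "finite A" and ann: "\<And>s. (\<And>i. i \<in> A \<Longrightarrow> s * a i = 0) \<Longrightarrow> s = 0"
  obtains c u where "\<And>i j. i \<in> A \<Longrightarrow> j \<in> A \<Longrightarrow> c i * c j = (if i = j then c i else 0)"
    and "u * (\<Sum>i\<in>A. c i * a i) = 1"
proof -
  have "A \<noteq> {}"
    using ann[of 1] by auto
  have "\<forall>i. \<exists>r. moderate r \<and> abs_gen_real r = a i"
    using gen_real_representative by blast
  then obtain r where r: "\<And>i. moderate (r i)" "\<And>i. abs_gen_real (r i) = a i"
    by metis
  define \<kappa> where "\<kappa> = (\<lambda>\<epsilon>. SOME i. i \<in> A \<and> (\<forall>j\<in>A. \<bar>r j \<epsilon>\<bar> \<le> \<bar>r i \<epsilon>\<bar>))"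
  have ex: "\<exists>i. i \<in> A \<and> (\<forall>j\<in>A. \<bar>r j \<epsilon>\<bar> \<le> \<bar>r i \<epsilon>\<bar>)" for \<epsilon>
  proof -
    have "Max ((\<lambda>i. \<bar>r i \<epsilon>\<bar>) ` A) \<in> (\<lambda>i. \<bar>r i \<epsilon>\<bar>) ` A"
      using fin \<open>A \<noteq> {}\<close> by simp
    then obtain i where "i \<in> A" "Max ((\<lambda>i. \<bar>r i \<epsilon>\<bar>) ` A) = \<bar>r i \<epsilon>\<bar>"
      by blast
    moreover have "\<bar>r j \<epsilon>\<bar> \<le> Max ((\<lambda>i. \<bar>r i \<epsilon>\<bar>) ` A)" if "j \<in> A" for j
      using fin that by (intro Max_ge) auto
    ultimately show ?thesis
      by auto
  qed
  have \<kappa>: "\<kappa> \<epsilon> \<in> A" "\<And>j. j \<in> A \<Longrightarrow> \<bar>r j \<epsilon>\<bar> \<le> \<bar>r (\<kappa> \<epsilon>) \<epsilon>\<bar>" for \<epsilon>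
    using someI_ex[OF ex[of \<epsilon>]] unfolding \<kappa>_def by auto
  define \<gamma> :: "'i \<Rightarrow> real \<Rightarrow> real" where "\<gamma> = (\<lambda>i \<epsilon>. if \<kappa> \<epsilon> = i then 1 else 0)"
  have \<gamma>: "moderate (\<gamma> i)" for i
    unfolding \<gamma>_def by (rule moderate_indicator)
  \<comment> \<open>A single net that dominates every \<open>r i\<close> with
    \<open>i \<in> A\<close>; it is the pointwise maximum with its sign kept, so that it equals the
    sum weighted by the indicators.\<close>
  define m where "m = (\<lambda>\<epsilon>. r (\<kappa> \<epsilon>) \<epsilon>)"
  have sum_m: "(\<Sum>i\<in>A. \<gamma> i \<epsilon> * r i \<epsilon>) = m \<epsilon>" for \<epsilon>
    using fin \<kappa>(1)[of \<epsilon>] by (simp add: \<gamma>_def m_def if_distrib[of "\<lambda>x. x * _"] cong: if_cong)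
  have "abs_gen_real (\<gamma> i) * a i = abs_gen_real (\<lambda>\<epsilon>. \<gamma> i \<epsilon> * r i \<epsilon>)" for i
    using abs_gen_real_mult[OF \<gamma> r(1), of i i] r(2) by simp
  then have m: "moderate m" "(\<Sum>i\<in>A. abs_gen_real (\<gamma> i) * a i) = abs_gen_real m"
    using abs_gen_real_sum[OF fin, of "\<lambda>i \<epsilon>. \<gamma> i \<epsilon> * r i \<epsilon>"] moderate_mult[OF \<gamma> r(1)]
    by (simp_all add: sum_m)
  \<comment> \<open>Without such a bound, some nonzero \<open>s\<close> kills every net dominated by
    \<open>m\<close>, hence all \<open>a i\<close>, contrary to \<open>ann\<close>.\<close>
  obtain N where N: "\<forall>\<^sub>F \<epsilon> in at_right 0. \<epsilon> ^ N \<le> \<bar>m \<epsilon>\<bar>"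
  proof (rule ccontr)
    assume "\<not> thesis"
    with that have small: "\<not> (\<forall>\<^sub>F \<epsilon> in at_right 0. \<epsilon> ^ N \<le> \<bar>m \<epsilon>\<bar>)" for N
      by blast
    obtain s where "s \<noteq> 0"
      and s: "\<And>r. moderate r \<Longrightarrow> (\<And>\<epsilon>. \<bar>r \<epsilon>\<bar> \<le> \<bar>m \<epsilon>\<bar>) \<Longrightarrow> s * abs_gen_real r = 0"
      using annihilator_of_small_net[OF small] by metis
    have "s * a i = 0" if "i \<in> A" for i
      using s[of "r i"] r \<kappa>(2) that by (simp add: m_def)
    with ann \<open>s \<noteq> 0\<close> show False
      by blast
  qed
  have pos: "\<forall>\<^sub>F \<epsilon> in at_right (0::real). 0 < \<epsilon>"
    by (rule eventually_at_right_less)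
  \<comment> \<open>Away from 0 the net \<open>m\<close> may vanish, and \<open>inverse\<close> then
    returns 0; the lower bound controls it near 0, which is all that the quotient sees.\<close>
  have inv: "moderate (\<lambda>\<epsilon>. inverse (m \<epsilon>))"
    unfolding moderate_def
  proof (intro exI landau_o.bigI[of 1])
    show "\<forall>\<^sub>F \<epsilon> in at_right 0. norm (inverse (m \<epsilon>)) \<le> 1 * norm (inverse (\<epsilon> ^ N))"
      using N pos by eventually_elim (simp add: le_imp_inverse_le)
  qed simp
  have "negligible_net (\<lambda>\<epsilon>. inverse (m \<epsilon>) * m \<epsilon> - 1)"
    unfolding negligible_net_def
  proof
    fix k :: nat
    show "(\<lambda>\<epsilon>. inverse (m \<epsilon>) * m \<epsilon> - 1) \<in> O[at_right 0](\<lambda>\<epsilon>. \<epsilon> ^ k)"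
    proof (rule landau_o.bigI[of 1])
      show "\<forall>\<^sub>F \<epsilon> in at_right 0. norm (inverse (m \<epsilon>) * m \<epsilon> - 1) \<le> 1 * norm (\<epsilon> ^ k)"
        using N pos
      proof eventually_elim
        case (elim \<epsilon>)
        then have "0 < \<bar>m \<epsilon>\<bar>"
          using zero_less_power[of \<epsilon> N] by linarith
        then show ?case
          by simp
      qed
    qed simp
  qed
  then have "abs_gen_real (\<lambda>\<epsilon>. inverse (m \<epsilon>)) * (\<Sum>i\<in>A. abs_gen_real (\<gamma> i) * a i) = 1"
    using abs_gen_real_eq_iff[OF moderate_mult[OF inv m(1)] moderate_const[of 1]]
    by (simp add: m abs_gen_real_mult inv one_gen_real_def)
  moreover have "abs_gen_real (\<gamma> i) * abs_gen_real (\<gamma> j) = (if i = j then abs_gen_real (\<gamma> i) else 0)" for i j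
  proof -
    have "(\<lambda>\<epsilon>. \<gamma> i \<epsilon> * \<gamma> j \<epsilon>) = (if i = j then \<gamma> i else (\<lambda>_. 0))"
      by (auto simp: \<gamma>_def)
    then show ?thesis
      by (simp add: abs_gen_real_mult \<gamma> zero_gen_real_def)
  qed
  ultimately show thesis
    by (intro that[of "\<lambda>i. abs_gen_real (\<gamma> i)" "abs_gen_real (\<lambda>\<epsilon>. inverse (m \<epsilon>))"])
qed

section \<open>Free modules\<close>

text \<open>Taking determinants makes \<open>det M\<close> a unit with inverse \<open>det N\<close>.
  Multiplying \<open>M * N = 1\<close> by the adjugate identifies \<open>N\<close> with
  \<open>det N\<close> times the adjugate of \<open>M\<close>, which is a left inverse as
  well.\<close>

lemma mat_mult_left_right_inverse_comm_ring:
  fixes M N :: "'a::comm_ring_1 mat"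
  assumes M: "M \<in> carrier_mat n n" and N: "N \<in> carrier_mat n n" and MN: "M * N = 1\<^sub>m n"
  shows "N * M = 1\<^sub>m n"
proof -
  note adj = adj_mat[OF M]
  have det: "det N * det M = 1"
    using det_mult[OF M N] MN by (simp add: mult.commute)
  have "adj_mat M = adj_mat M * (M * N)"
    using adj MN by simp
  also have "\<dots> = adj_mat M * M * N"
    using adj(1) M N by (simp only: assoc_mult_mat)
  also have "\<dots> = det M \<cdot>\<^sub>m N"
    using adj(3) mult_smult_assoc_mat[OF one_carrier_mat N, of "det M"] N by simp
  finally have "det N \<cdot>\<^sub>m adj_mat M = N"
    using det N by (auto simp flip: mult.assoc)
  then have "N * M = det N \<cdot>\<^sub>m (adj_mat M * M)"
    using mult_smult_assoc_mat[OF adj(1) M, of "det N"] by simp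
  then show ?thesis
    using adj(3) det by (auto simp flip: mult.assoc)
qed

text \<open>Enumerating both index sets reduces this to matrices. Later \<open>A\<close> indexes a
  family of vectors and \<open>B\<close> is a basis.\<close>

lemma sum_mult_left_right_inverse:
  fixes M :: "'i \<Rightarrow> 'j \<Rightarrow> 'a::comm_ring_1"
  assumes "finite A" "finite B" "card A = card B"
    and MN: "\<And>a a'. a \<in> A \<Longrightarrow> a' \<in> A \<Longrightarrow> (\<Sum>b\<in>B. M a b * N b a') = (if a = a' then 1 else 0)"
    and "b \<in> B" "b' \<in> B"
  shows "(\<Sum>a\<in>A. N b a * M a b') = (if b = b' then 1 else 0)"
proof -
  define m where "m = card A"
  obtain \<alpha> where \<alpha>: "bij_betw \<alpha> {0..<m} A"
    using ex_bij_betw_nat_finite[OF assms(1)] m_def by blast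
  obtain \<beta> where \<beta>: "bij_betw \<beta> {0..<m} B"
    using ex_bij_betw_nat_finite[OF assms(2)] m_def assms(3) by auto
  define M' where "M' = mat m m (\<lambda>(i, j). M (\<alpha> i) (\<beta> j))"
  define N' where "N' = mat m m (\<lambda>(j, i). N (\<beta> j) (\<alpha> i))"
  have "M' * N' = 1\<^sub>m m"
  proof (rule eq_matI)
    fix i k assume ik: "i < dim_row (1\<^sub>m m)" "k < dim_col (1\<^sub>m m)"
    have "(M' * N') $$ (i, k) = (\<Sum>j = 0..<m. M (\<alpha> i) (\<beta> j) * N (\<beta> j) (\<alpha> k))"
      using ik by (simp add: M'_def N'_def scalar_prod_def)
    also have "\<dots> = (\<Sum>b\<in>B. M (\<alpha> i) b * N b (\<alpha> k))"
      by (rule sum.reindex_bij_betw[OF \<beta>])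
    also have "\<dots> = (if \<alpha> i = \<alpha> k then 1 else 0)"
      using ik bij_betwE[OF \<alpha>] by (intro MN) auto
    also have "\<dots> = 1\<^sub>m m $$ (i, k)"
      using ik bij_betw_imp_inj_on[OF \<alpha>] by (auto simp: inj_on_def)
    finally show "(M' * N') $$ (i, k) = 1\<^sub>m m $$ (i, k)" .
  qed (simp_all add: M'_def N'_def)
  from mat_mult_left_right_inverse_comm_ring[OF _ _ this] have NM: "N' * M' = 1\<^sub>m m"
    by (simp add: M'_def N'_def)
  have "b \<in> \<beta> ` {0..<m}" "b' \<in> \<beta> ` {0..<m}"
    using bij_betw_imp_surj_on[OF \<beta>] assms(5,6) by simp_all
  then obtain j l where jl: "j < m" "l < m" "b = \<beta> j" "b' = \<beta> l"
    by auto
  have "(\<Sum>a\<in>A. N b a * M a b') = (\<Sum>i = 0..<m. N b (\<alpha> i) * M (\<alpha> i) b')"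
    by (rule sum.reindex_bij_betw[OF \<alpha>, symmetric])
  also have "\<dots> = (N' * M') $$ (j, l)"
    using jl by (simp add: M'_def N'_def scalar_prod_def)
  also have "\<dots> = (if b = b' then 1 else 0)"
    using jl bij_betw_imp_inj_on[OF \<beta>] by (auto simp: NM inj_on_def)
  finally show ?thesis .
qed

section \<open>Free families and spanning families\<close>

context Modules.module
begin

text \<open>A repetition \<open>x a = x b\<close> would be a relation with coefficients 1 and -1.
  Once \<open>x\<close> is injective, coefficients can be moved between \<open>A\<close> and its
  image.\<close>

lemma free_family_iff:
  assumes fin: "finite A"
  shows "free_family A x \<longleftrightarrow> (\<forall>u. (\<Sum>a\<in>A. u a *s x a) = 0 \<longrightarrow> (\<forall>a\<in>A. u a = 0))"
proof (intro iffI allI impI ballI)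
  fix u a assume "free_family A x" and u: "(\<Sum>a\<in>A. u a *s x a) = 0" "a \<in> A"
  then have inj: "inj_on x A" and ind: "independent (x ` A)"
    by (simp_all add: free_family_def)
  have "(\<Sum>v\<in>x ` A. u (the_inv_into A x v) *s v) = (\<Sum>a\<in>A. u a *s x a)"
    unfolding sum.reindex[OF inj] by (intro sum.cong) (simp_all add: the_inv_into_f_f[OF inj])
  then have "(\<Sum>v\<in>x ` A. u (the_inv_into A x v) *s v) = 0"
    using u(1) by simp
  from independentD[OF ind _ order_refl this, of "x a"] show "u a = 0"
    using fin u(2) by (simp add: the_inv_into_f_f[OF inj])
next
  assume *: "\<forall>u. (\<Sum>a\<in>A. u a *s x a) = 0 \<longrightarrow> (\<forall>a\<in>A. u a = 0)"
  have inj: "inj_on x A"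
  proof (rule inj_onI, rule ccontr)
    fix a b assume ab: "a \<in> A" "b \<in> A" "x a = x b" "a \<noteq> b"
    define u :: "_ \<Rightarrow> 'a" where "u = (\<lambda>c. (if c = a then 1 else 0) - (if c = b then 1 else 0))"
    have "(\<Sum>c\<in>A. u c *s x c) = x a - x b"
      using fin ab
      by (simp add: u_def scale_left_diff_distrib sum_subtractf if_distrib[of "\<lambda>r. r *s _"] cong: if_cong)
    with * ab have "u a = 0"
      by simp
    with ab show False
      by (simp add: u_def)
  qed
  moreover have "independent (x ` A)"
    unfolding independent_explicit_module
  proof (intro allI impI)
    fix t u v assume t: "finite t" "t \<subseteq> x ` A" "(\<Sum>v\<in>t. u v *s v) = 0" "v \<in> t"
    define w where "w = (\<lambda>a. if x a \<in> t then u (x a) else 0)"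
    have "(\<Sum>a\<in>A. w a *s x a) = (\<Sum>v\<in>x ` A. (if v \<in> t then u v else 0) *s v)"
      by (simp add: sum.reindex[OF inj] w_def)
    also have "\<dots> = (\<Sum>v\<in>t. u v *s v)"
      using fin t(2) by (intro sum.mono_neutral_cong_right) auto
    finally have "\<forall>a\<in>A. w a = 0"
      using * t(3) by simp
    moreover obtain a where "a \<in> A" "v = x a"
      using t(2,4) by blast
    ultimately show "u v = 0"
      using t(4) by (auto simp: w_def)
  qed
  ultimately show "free_family A x"
    by (simp add: free_family_def)
qed

text \<open>Applying \<open>\<psi>\<close> to a linear relation removes the old vectors and leaves
  the new coefficient times \<open>\<psi> (y i)\<close>. The separate \<open>y\<close> allows for a
  family obtained by a function update.\<close>

lemma free_family_insert_hom:
  assumes fin: "finite A" and free: "free_family A x" and "i \<notin> A"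
    and eq: "\<And>a. a \<in> A \<Longrightarrow> y a = x a"
    and hom: "module_hom scale scale' \<psi>"
    and zero: "\<And>a. a \<in> A \<Longrightarrow> \<psi> (x a) = 0"
    and new: "\<And>c. scale' c (\<psi> (y i)) = 0 \<Longrightarrow> c = 0"
  shows "free_family (insert i A) y"
proof -
  interpret \<psi>: module_hom scale scale' \<psi>
    by fact
  have "u i = 0 \<and> (\<forall>a\<in>A. u a = 0)" if u: "(\<Sum>a\<in>insert i A. u a *s y a) = 0" for u
  proof -
    have *: "u i *s y i + (\<Sum>a\<in>A. u a *s x a) = 0"
      using u fin \<open>i \<notin> A\<close> eq by simp
    have "scale' (u i) (\<psi> (y i)) = \<psi> (u i *s y i + (\<Sum>a\<in>A. u a *s x a))"
      by (simp add: \<psi>.add \<psi>.sum \<psi>.scale zero)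
    then have "u i = 0"
      using new \<psi>.zero by (simp add: *)
    then show ?thesis
      using * free free_family_iff[OF fin] by simp
  qed
  then show ?thesis
    using fin by (simp add: free_family_iff)
qed

text \<open>Expand \<open>v\<close> in the basis \<open>B\<close>. In this form the identity is a
  matrix product of the values of functionals with coordinates; it also computes traces of rank-one
  maps.\<close>

lemma sum_hom_mult_representation:
  assumes "module_hom scale (*) \<phi>" "finite B" "independent B" "span B = UNIV"
  shows "(\<Sum>b\<in>B. \<phi> b * representation B v b) = \<phi> v"
proof -
  interpret \<phi>: module_hom scale "(*)" \<phi>
    by fact
  have "(\<Sum>b\<in>B. \<phi> b * representation B v b) = \<phi> (\<Sum>b\<in>B. representation B v b *s b)"
    by (simp add: \<phi>.sum \<phi>.scale mult.commute)
  also have "\<dots> = \<phi> v"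
    using sum_representation_eq[of B v B] assms by simp
  finally show ?thesis .
qed

text \<open>In coordinates, \<open>dual\<close> says that two square matrices have product 1. The
  product in the other order is then 1 too, which writes each basis vector \<open>b'\<close> as the
  combination of the \<open>x a\<close> with coefficients \<open>\<phi> a b'\<close>.\<close>

lemma span_eq_UNIV_of_dual_family:
  assumes rank: "free_of_rank m" and A: "finite A" "card A = m"
    and hom: "\<And>a. a \<in> A \<Longrightarrow> module_hom scale (*) (\<phi> a)"
    and dual: "\<And>a b. a \<in> A \<Longrightarrow> b \<in> A \<Longrightarrow> \<phi> a (x b) = (if a = b then 1 else 0)"
  shows "span (x ` A) = UNIV"
proof -
  obtain B where B: "finite B" "card B = m" "independent B" "span B = UNIV"
    using rank unfolding free_of_rank_def by blast
  have "b' \<in> span (x ` A)" if b': "b' \<in> B" for b'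
  proof -
    have rep: "(\<Sum>a\<in>A. representation B (x a) b * \<phi> a b') = (if b = b' then 1 else 0)" if "b \<in> B" for b
    proof (rule sum_mult_left_right_inverse[OF A(1) B(1)])
      fix a a' assume "a \<in> A" "a' \<in> A"
      then show "(\<Sum>b\<in>B. \<phi> a b * representation B (x a') b) = (if a = a' then 1 else 0)"
        using sum_hom_mult_representation[OF hom B(1,3,4)] dual by simp
    qed (use A B b' that in auto)
    have "b' = (\<Sum>b\<in>B. (if b = b' then 1 else 0) *s b)"
      using B(1) b' by (simp add: if_distrib[of "\<lambda>r. r *s _"] cong: if_cong)
    also have "\<dots> = (\<Sum>b\<in>B. (\<Sum>a\<in>A. representation B (x a) b * \<phi> a b') *s b)"
      by (simp add: rep)
    also have "\<dots> = (\<Sum>a\<in>A. \<phi> a b' *s (\<Sum>b\<in>B. representation B (x a) b *s b))"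
      by (simp add: scale_sum_left scale_sum_right mult.commute sum.swap[of _ B A])
    also have "\<dots> = (\<Sum>a\<in>A. \<phi> a b' *s x a)"
      using sum_representation_eq[of B _ B] B by simp
    also have "\<dots> \<in> span (x ` A)"
      by (intro span_sum span_scale span_base imageI)
    finally show ?thesis .
  qed
  then have "span B \<subseteq> span (x ` A)"
    by (intro span_minimal) auto
  with B show ?thesis
    by auto
qed

end

section \<open>Symplectic modules\<close>

context symplectic_module
begin

section \<open>Pairings and dual families\<close>

lemmas \<sigma>_left =
  module_hom.zero[OF linear_left] module_hom.add[OF linear_left] module_hom.diff[OF linear_left]
  module_hom.neg[OF linear_left] module_hom.sum[OF linear_left] module_hom.scale[OF linear_left]

lemmas \<sigma>_right =
  module_hom.zero[OF linear_right] module_hom.add[OF linear_right] module_hom.diff[OF linear_right]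
  module_hom.neg[OF linear_right] module_hom.sum[OF linear_right] module_hom.scale[OF linear_right]

text \<open>Skew symmetry gives \<open>2 * \<sigma> v v = 0\<close>, and 2 is invertible.\<close>

lemma \<sigma>_self: "\<sigma> v v = 0"
proof -
  have "of_nat 2 * \<sigma> v v = \<sigma> v v + \<sigma> v v"
    by simp
  also have "\<dots> = 0"
    using skew_symmetric[of v v] by (metis add.right_inverse)
  finally show ?thesis
    by (rule of_nat_mult_gen_real_eq_0) simp
qed

text \<open>If \<open>s\<close> kills all \<open>\<sigma> b x\<close>, then \<open>scale s x\<close>
  is orthogonal to everything, so it is 0 by non-degeneracy and \<open>s = 0\<close>. Hence some
  linear combination of the values \<open>\<sigma> b x\<close> is 1.\<close>

lemma ex_sigma_eq_1:
  assumes B: "finite B" "span B = UNIV" and x: "\<And>r. scale r x = 0 \<Longrightarrow> r = 0"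
  obtains w where "\<sigma> w x = 1"
proof -
  have ann: "s = 0" if s: "\<And>b. b \<in> B \<Longrightarrow> s * \<sigma> b x = 0" for s
  proof (rule x, rule non_degenerate)
    fix v
    have "v \<in> span B"
      by (simp add: B)
    then show "\<sigma> v (scale s x) = 0"
    proof (induction rule: span_induct)
      case base
      show ?case
        by (rule subspaceI) (simp_all add: \<sigma>_left)
    next
      case (step b)
      then show ?case
        using s by (simp add: \<sigma>_right)
    qed
  qed
  obtain c u where "u * (\<Sum>b\<in>B. c b * \<sigma> b x) = 1"
    by (rule orthogonal_idempotents_unit[OF B(1) ann])
  then have "\<sigma> (scale u (\<Sum>b\<in>B. scale (c b) b)) x = 1"
    by (simp add: \<sigma>_left)
  then show thesis
    by (rule that)
qed

lemma ex_dual_family: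
  assumes B: "finite B" "span B = UNIV" and "finite A" "free_family A x"
  shows "\<exists>y. \<forall>a\<in>A. \<forall>b\<in>A. \<sigma> (y a) (x b) = (if a = b then 1 else 0)"
  using assms(3,4)
proof (induction A rule: finite_induct)
  case empty
  then show ?case
    by simp
next
  case (insert i A)
  have "free_family A x"
    using insert.prems by (auto simp: free_family_def dest: independent_mono[OF _ subset_insertI])
  with insert.IH obtain y
    where y: "\<And>a b. a \<in> A \<Longrightarrow> b \<in> A \<Longrightarrow> \<sigma> (y a) (x b) = (if a = b then 1 else 0)"
    by blast
  \<comment> \<open>The new vector is corrected so that all old dual vectors vanish on it; its
    coefficient at \<open>x i\<close> stays 1, which keeps it free.\<close>
  define x' where "x' = x i - (\<Sum>a\<in>A. scale (\<sigma> (y a) (x i)) (x a))"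
  have yx': "\<sigma> (y b) x' = 0" if "b \<in> A" for b
    using insert.hyps(1) that
    by (simp add: x'_def \<sigma>_right y if_distrib[of "\<lambda>r. _ * r"] cong: if_cong)
  obtain w where w: "\<sigma> w x' = 1"
  proof (rule ex_sigma_eq_1[OF B])
    fix r assume r: "scale r x' = 0"
    define u where "u = (\<lambda>a. if a = i then r else - (r * \<sigma> (y a) (x i)))"
    have "(\<Sum>a\<in>A. scale (u a) (x a)) = (\<Sum>a\<in>A. - scale r (scale (\<sigma> (y a) (x i)) (x a)))"
      using insert.hyps(2) by (intro sum.cong) (auto simp: u_def)
    then have "(\<Sum>a\<in>insert i A. scale (u a) (x a)) = scale r x'"
      using insert.hyps
      by (simp add: u_def x'_def scale_right_diff_distrib scale_sum_right sum_negf)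
    with r have "u i = 0"
      using insert.prems insert.hyps(1) free_family_iff[of "insert i A" x] by simp
    then show "r = 0"
      by (simp add: u_def)
  qed
  \<comment> \<open>This makes \<open>w\<close> vanish on the old \<open>x a\<close> and keeps the
    value 1 on \<open>x'\<close>, where the \<open>y a\<close> vanish. As \<open>x i\<close> and
    \<open>x'\<close> differ by old vectors, \<open>z\<close> takes the value 1 on
    \<open>x i\<close> too.\<close>
  define z where "z = w - (\<Sum>a\<in>A. scale (\<sigma> w (x a)) (y a))"
  have zx: "\<sigma> z (x b) = 0" if "b \<in> A" for b
    using insert.hyps(1) that
    by (simp add: z_def \<sigma>_left y if_distrib[of "\<lambda>r. _ * r"] cong: if_cong)
  have "\<sigma> z x' = 1"
    by (simp add: z_def \<sigma>_left w yx')
  then have zi: "\<sigma> z (x i) = 1"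
    by (simp add: x'_def \<sigma>_right zx)
  \<comment> \<open>The old dual vectors are made to vanish on \<open>x i\<close>; their values on
    the old family do not change, since \<open>z\<close> is 0 there.\<close>
  define y' where "y' = (\<lambda>a. if a = i then z else y a - scale (\<sigma> (y a) (x i)) z)"
  have "\<forall>a\<in>insert i A. \<forall>b\<in>insert i A. \<sigma> (y' a) (x b) = (if a = b then 1 else 0)"
    using insert.hyps(2) by (auto simp: y'_def \<sigma>_left y zx zi)
  then show ?case
    by blast
qed

text \<open>Over a general ring this fails, as 2 in the integers shows. Here a dual family
  \<open>y\<close> supplies the functionals \<open>\<sigma> (y a)\<close> that yield
  spanning.\<close>

lemma span_eq_UNIV_of_free_family:
  assumes rank: "free_of_rank (card A)" and "finite A" "free_family A x"
  shows "span (x ` A) = UNIV"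
proof -
  obtain B where "finite B" "span B = UNIV"
    using rank unfolding free_of_rank_def by blast
  with assms obtain y
    where "\<And>a b. a \<in> A \<Longrightarrow> b \<in> A \<Longrightarrow> \<sigma> (y a) (x b) = (if a = b then 1 else 0)"
    using ex_dual_family[of B A x] by blast
  then show ?thesis
    using assms linear_right by (intro span_eq_UNIV_of_dual_family[of "card A" A "\<lambda>a. \<sigma> (y a)"]) auto
qed

section \<open>The orthogonal complement of hyperbolic pairs\<close>

text \<open>For hyperbolic pairs this is the projection onto their orthogonal complement along their
  span. The argument orders match \<open>\<sigma> (f k) (e k) = 1\<close>, so both terms carry the
  same sign.\<close>

definition complement_projection :: "nat set \<Rightarrow> (nat \<Rightarrow> 'v) \<Rightarrow> (nat \<Rightarrow> 'v) \<Rightarrow> 'v \<Rightarrow> 'v" where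
  "complement_projection K e f v =
     v - (\<Sum>k\<in>K. scale (\<sigma> (f k) v) (e k) + scale (\<sigma> v (e k)) (f k))"

lemma complement_projection_hom: "module_hom scale scale (complement_projection K e f)"
proof (intro module_hom.intro module_hom_axioms.intro module_axioms)
  fix v w
  show "complement_projection K e f (v + w) = complement_projection K e f v + complement_projection K e f w"
    by (simp add: complement_projection_def \<sigma>_left \<sigma>_right scale_left_distrib sum.distrib)
next
  fix r v
  show "complement_projection K e f (scale r v) = scale r (complement_projection K e f v)"
    by (simp add: complement_projection_def \<sigma>_left \<sigma>_right scale_right_diff_distrib
        scale_sum_right scale_right_distrib)
qed

lemma complement_projection_of_orthogonal:
  assumes "\<And>k. k \<in> K \<Longrightarrow> \<sigma> (e k) w = 0" "\<And>k. k \<in> K \<Longrightarrow> \<sigma> (f k) w = 0"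
  shows "complement_projection K e f w = w"
proof -
  have "\<sigma> w (e k) = 0" if "k \<in> K" for k
    using assms(1)[OF that] skew_symmetric[of w "e k"] by simp
  then show ?thesis
    using assms(2) by (simp add: complement_projection_def)
qed

lemma symplectic_relationsD:
  assumes "symplectic_relations I J e f"
  shows "i \<in> I \<Longrightarrow> k \<in> I \<Longrightarrow> \<sigma> (e i) (e k) = 0"
    and "j \<in> J \<Longrightarrow> l \<in> J \<Longrightarrow> \<sigma> (f j) (f l) = 0"
    and "j \<in> J \<Longrightarrow> i \<in> I \<Longrightarrow> \<sigma> (f j) (e i) = (if j = i then 1 else 0)"
    and "j \<in> J \<Longrightarrow> i \<in> I \<Longrightarrow> \<sigma> (e i) (f j) = (if j = i then - 1 else 0)"
  using assms skew_symmetric[of "e i" "f j"] unfolding symplectic_relations_def by auto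

lemma complement_projection_orthogonal:
  assumes rel: "symplectic_relations K K e f" and "finite K" "k \<in> K"
  shows "complement_projection K e f (e k) = 0" "complement_projection K e f (f k) = 0"
    and "\<sigma> (e k) (complement_projection K e f v) = 0" "\<sigma> (f k) (complement_projection K e f v) = 0"
  using assms(2,3) skew_symmetric[of v "e k"]
  by (simp_all add: complement_projection_def \<sigma>_right symplectic_relationsD[OF rel]
      if_distrib[of "\<lambda>r. scale r _"] if_distrib[of "\<lambda>r. _ * r"] cong: if_cong)

text \<open>
  The orthogonal complement of \<open>card K\<close> hyperbolic pairs contains a free vector because the
  projection onto it has trace \<open>2 * (n - card K)\<close>, which is invertible: its diagonal entries
  have no common annihilator.
\<close>

lemma ex_free_orthogonal:
  assumes rank: "free_of_rank (2 * n)" and K: "finite K" "card K < n"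
    and rel: "symplectic_relations K K e f"
  obtains w where "\<And>k. k \<in> K \<Longrightarrow> \<sigma> (e k) w = 0" "\<And>k. k \<in> K \<Longrightarrow> \<sigma> (f k) w = 0"
    and "\<And>r. scale r w = 0 \<Longrightarrow> r = 0"
proof -
  obtain B where B: "finite B" "card B = 2 * n" "independent B" "span B = UNIV"
    using rank unfolding free_of_rank_def by blast
  define R where "R = representation B"
  have R_zero: "R 0 b = 0" for b
    by (simp add: R_def representation_zero)
  have R_scale: "R (scale r v) b = r * R v b" for r v b
    using B by (simp add: R_def representation_scale)
  have R_add: "R (v + w) b = R v b + R w b" for v w b
    using B by (simp add: R_def representation_add)
  have R_diff: "R (v - w) b = R v b - R w b" for v w b
    using B by (simp add: R_def representation_diff)
  have R_sum: "R (\<Sum>k\<in>S. g k) b = (\<Sum>k\<in>S. R (g k) b)" for g :: "nat \<Rightarrow> 'v" and S b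
    by (induction S rule: infinite_finite_induct) (simp_all add: R_zero R_add)
  define p where "p = complement_projection K e f"
  \<comment> \<open>These are the diagonal entries of the matrix of \<open>p\<close> in the basis
    \<open>B\<close>.\<close>
  have entry: "R (p b) b = 1 - (\<Sum>k\<in>K. \<sigma> (f k) b * R (e k) b + \<sigma> b (e k) * R (f k) b)"
    if "b \<in> B" for b
    using that B(3)
    by (simp add: p_def complement_projection_def R_diff R_sum R_add R_scale)
      (simp add: R_def representation_basis)
  \<comment> \<open>Each of the two rank-one maps belonging to \<open>k\<close> has trace
    \<open>\<sigma> (f k) (e k)\<close>, so each pair lowers the trace by 2.\<close>
  have hom: "(\<Sum>b\<in>B. \<sigma> (f k) b * R (e k) b) = \<sigma> (f k) (e k)"
    "(\<Sum>b\<in>B. \<sigma> b (e k) * R (f k) b) = \<sigma> (f k) (e k)" for k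
    unfolding R_def
    by (rule sum_hom_mult_representation[OF linear_right B(1,3,4)]
        sum_hom_mult_representation[OF linear_left B(1,3,4)])+
  have "(\<Sum>b\<in>B. R (p b) b) =
      (\<Sum>b\<in>B. 1 - (\<Sum>k\<in>K. \<sigma> (f k) b * R (e k) b + \<sigma> b (e k) * R (f k) b))"
    by (rule sum.cong) (simp_all add: entry)
  also have "\<dots> = of_nat (2 * n) - (\<Sum>k\<in>K. \<sigma> (f k) (e k) + \<sigma> (f k) (e k))"
    by (subst sum_subtractf, subst sum.swap[of _ K B]) (simp add: sum.distrib hom B(2))
  also have "(\<Sum>k\<in>K. \<sigma> (f k) (e k) + \<sigma> (f k) (e k)) = (\<Sum>k\<in>K. 2)"
    by (rule sum.cong) (simp_all add: symplectic_relationsD(3)[OF rel])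
  also have "of_nat (2 * n) - \<dots> = of_nat (2 * n) - of_nat (2 * card K)"
    by (simp add: mult.commute)
  also have "\<dots> = of_nat (2 * n - 2 * card K)"
    using K(2) by (intro of_nat_diff[symmetric]) simp
  finally have trace: "(\<Sum>b\<in>B. R (p b) b) = of_nat (2 * n - 2 * card K)" .
  have ann: "s = 0" if s: "\<And>b. b \<in> B \<Longrightarrow> s * R (p b) b = 0" for s
  proof (rule of_nat_mult_gen_real_eq_0)
    have "s * (\<Sum>b\<in>B. R (p b) b) = 0"
      by (simp add: sum_distrib_left s)
    then show "of_nat (2 * n - 2 * card K) * s = 0"
      unfolding trace by (simp only: mult.commute)
  qed (use K(2) in simp)
  obtain c u where c: "\<And>i j. i \<in> B \<Longrightarrow> j \<in> B \<Longrightarrow> c i * c j = (if i = j then c i else 0)"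
    and u: "u * (\<Sum>b\<in>B. c b * R (p b) b) = 1"
    by (rule orthogonal_idempotents_unit[OF B(1), of "\<lambda>b. R (p b) b"])
      (rule ann, simp, rule that, simp_all)
  \<comment> \<open>By orthogonality of the idempotents, scaling \<open>w\<close> by
    \<open>c b\<close> isolates \<open>scale (c b) (p b)\<close>. So \<open>scale r w = 0\<close>
    forces \<open>r\<close> to kill every \<open>c b * R (p b) b\<close>, and therefore the unit
    formed by their sum.\<close>
  define w where "w = (\<Sum>b\<in>B. scale (c b) (p b))"
  show thesis
  proof (rule that[of w])
    fix k assume "k \<in> K"
    then show "\<sigma> (e k) w = 0" "\<sigma> (f k) w = 0"
      using complement_projection_orthogonal[OF rel K(1)] by (simp_all add: w_def p_def \<sigma>_right)
  next
    fix r assume r: "scale r w = 0"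
    have "r * (c b * R (p b) b) = 0" if b: "b \<in> B" for b
    proof -
      have "scale (c b) w = (\<Sum>b'\<in>B. if b = b' then scale (c b) (p b) else 0)"
        unfolding w_def scale_sum_right using b by (intro sum.cong) (simp_all add: c)
      also have "\<dots> = scale (c b) (p b)"
        using B(1) b by simp
      finally have "scale (r * c b) (p b) = scale (c b) (scale r w)"
        by (metis scale_left_commute scale_scale)
      then have "R (scale (r * c b) (p b)) b = 0"
        by (simp add: r R_zero)
      then show ?thesis
        by (simp add: R_scale mult.assoc)
    qed
    then have "r * (\<Sum>b\<in>B. c b * R (p b) b) = 0"
      by (simp add: sum_distrib_left)
    then have "r * (u * (\<Sum>b\<in>B. c b * R (p b) b)) = 0"
      by (simp only: mult.left_commute[of r u] mult_zero_right)
    then show "r = 0"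
      by (simp add: u)
  qed
qed

section \<open>Adding one vector\<close>

text \<open>The dual vector of \<open>e i\<close> satisfies the relations required of
  \<open>f i\<close>. Pairing with \<open>e i\<close> vanishes on all given vectors because
  \<open>i \<notin> J\<close>, but is 1 on the new one, so the family stays free.\<close>

lemma ex_extend_f:
  assumes B: "finite B" "span B = UNIV" and fin: "finite I" "finite J"
    and free: "free_family (I <+> J) (case_sum e f)" and rel: "symplectic_relations I J e f"
    and i: "i \<in> I" "i \<notin> J"
  obtains w where "free_family (I <+> insert i J) (case_sum e (f(i := w)))"
    and "symplectic_relations I (insert i J) e (f(i := w))"
proof -
  obtain y where y: "\<And>a b. a \<in> I <+> J \<Longrightarrow> b \<in> I <+> J \<Longrightarrow>
      \<sigma> (y a) (case_sum e f b) = (if a = b then 1 else 0)"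
    using ex_dual_family[OF B _ free] fin by auto
  define w where "w = y (Inl i)"
  have we: "\<sigma> w (e k) = (if i = k then 1 else 0)" if "k \<in> I" for k
    using y[OF InlI[OF i(1)] InlI[OF that]] by (auto simp: w_def)
  have wf: "\<sigma> w (f j) = 0" "\<sigma> (f j) w = 0" if "j \<in> J" for j
    using y[OF InlI[OF i(1)] InrI[OF that]] skew_symmetric[of "f j" w] by (auto simp: w_def)
  have "free_family (insert (Inr i) (I <+> J)) (case_sum e (f(i := w)))"
  proof (rule free_family_insert_hom[OF _ free _ _ linear_left[of "e i"]])
    fix a assume a: "a \<in> I <+> J"
    then show "case_sum e (f(i := w)) a = case_sum e f a" "\<sigma> (case_sum e f a) (e i) = 0"
      using i by (auto simp: symplectic_relationsD[OF rel])
  qed (use fin i in \<open>auto simp: we\<close>)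
  moreover have "insert (Inr i) (I <+> J) = I <+> insert i J"
    by auto
  moreover have "symplectic_relations I (insert i J) e (f(i := w))"
    using i unfolding symplectic_relations_def
    by (auto simp: symplectic_relationsD[OF rel] \<sigma>_self we wf)
  ultimately show thesis
    using that by simp
qed

text \<open>The mirror image of adding a missing \<open>f i\<close>: pairing with \<open>f j\<close>
  now separates the new vector from the given ones.\<close>

lemma ex_extend_e:
  assumes B: "finite B" "span B = UNIV" and fin: "finite I" "finite J"
    and free: "free_family (I <+> J) (case_sum e f)" and rel: "symplectic_relations I J e f"
    and j: "j \<in> J" "j \<notin> I"
  obtains w where "free_family (insert j I <+> J) (case_sum (e(j := w)) f)"
    and "symplectic_relations (insert j I) J (e(j := w)) f"
proof -
  obtain y where y: "\<And>a b. a \<in> I <+> J \<Longrightarrow> b \<in> I <+> J \<Longrightarrow>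
      \<sigma> (y a) (case_sum e f b) = (if a = b then 1 else 0)"
    using ex_dual_family[OF B _ free] fin by auto
  \<comment> \<open>The sign compensates for the swapped arguments in
    \<open>\<sigma> (f j) w = 1\<close>.\<close>
  define w where "w = - y (Inr j)"
  have wf: "\<sigma> (f l) w = (if l = j then 1 else 0)" if "l \<in> J" for l
    using y[OF InrI[OF j(1)] InrI[OF that]] skew_symmetric[of "f l" w]
    by (auto simp: w_def \<sigma>_left)
  have we: "\<sigma> w (e i) = 0" "\<sigma> (e i) w = 0" if "i \<in> I" for i
    using y[OF InrI[OF j(1)] InlI[OF that]] skew_symmetric[of "e i" w] by (auto simp: w_def \<sigma>_left)
  have "free_family (insert (Inl j) (I <+> J)) (case_sum (e(j := w)) f)"
  proof (rule free_family_insert_hom[OF _ free _ _ linear_right[of "f j"]])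
    fix a assume a: "a \<in> I <+> J"
    then show "case_sum (e(j := w)) f a = case_sum e f a" "\<sigma> (f j) (case_sum e f a) = 0"
      using j by (auto simp: symplectic_relationsD[OF rel])
  qed (use fin j in \<open>auto simp: wf\<close>)
  moreover have "insert (Inl j) (I <+> J) = insert j I <+> J"
    by auto
  moreover have "symplectic_relations (insert j I) J (e(j := w)) f"
    using j unfolding symplectic_relations_def
    by (auto simp: symplectic_relationsD[OF rel] \<sigma>_self we wf)
  ultimately show thesis
    using that by simp
qed

text \<open>No given vector has the index \<open>j\<close>, so there is no partner to dualize. A
  free vector of the complement serves as \<open>e j\<close>: the projection fixes it and kills the
  given vectors, which proves freeness.\<close>

lemma ex_extend_orthogonal:
  assumes rank: "free_of_rank (2 * n)" and K: "finite K" "card K < n"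
    and free: "free_family (K <+> K) (case_sum e f)" and rel: "symplectic_relations K K e f"
    and j: "j \<notin> K"
  obtains w where "free_family (insert j K <+> K) (case_sum (e(j := w)) f)"
    and "symplectic_relations (insert j K) K (e(j := w)) f"
proof -
  obtain w where we: "\<And>k. k \<in> K \<Longrightarrow> \<sigma> (e k) w = 0" and wf: "\<And>k. k \<in> K \<Longrightarrow> \<sigma> (f k) w = 0"
    and w: "\<And>r. scale r w = 0 \<Longrightarrow> r = 0"
    using ex_free_orthogonal[OF rank K rel] by blast
  have we': "\<sigma> w (e k) = 0" if "k \<in> K" for k
    using skew_symmetric[of w "e k"] we[OF that] by simp
  have "free_family (insert (Inl j) (K <+> K)) (case_sum (e(j := w)) f)"
  proof (rule free_family_insert_hom[OF _ free _ _ complement_projection_hom[of K e f]])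
    fix a assume a: "a \<in> K <+> K"
    then show "case_sum (e(j := w)) f a = case_sum e f a"
      "complement_projection K e f (case_sum e f a) = 0"
      using j complement_projection_orthogonal[OF rel K(1)] by auto
  next
    fix c assume "scale c (complement_projection K e f (case_sum (e(j := w)) f (Inl j))) = 0"
    then show "c = 0"
      using w complement_projection_of_orthogonal[of K e w f] we wf by simp
  qed (use K j in auto)
  moreover have "insert (Inl j) (K <+> K) = insert j K <+> K"
    by auto
  moreover have "symplectic_relations (insert j K) K (e(j := w)) f"
    using j unfolding symplectic_relations_def
    by (auto simp: symplectic_relationsD[OF rel] \<sigma>_self we we' wf)
  ultimately show thesis
    using that by simp
qed

text \<open>Induction on the number of missing vectors. Unequal index sets allow a partner to be
  added; equal but incomplete ones call for a new \<open>e j\<close>, whose partner comes in the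
  following step.\<close>

lemma ex_symplectic_basis_extension:
  assumes rank: "free_of_rank (2 * n)"
    and "I \<subseteq> {1..n}" "J \<subseteq> {1..n}"
    and "free_family (I <+> J) (case_sum e f)" "symplectic_relations I J e f"
  shows "\<exists>e' f'. (\<forall>i\<in>I. e' i = e i) \<and> (\<forall>j\<in>J. f' j = f j) \<and> symplectic_basis n e' f'"
  using assms(2-)
proof (induction "2 * n - (card I + card J)" arbitrary: I J e f rule: less_induct)
  case less
  note I = less.prems(1) and J = less.prems(2) and free = less.prems(3) and rel = less.prems(4)
  obtain B where B: "finite B" "span B = UNIV"
    using rank unfolding free_of_rank_def by blast
  have fin: "finite I" "finite J"
    using I J finite_subset by blast+
  \<comment> \<open>Subtraction is truncated at 0; the inclusions in \<open>{1..n}\<close> keep the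
    new count within \<open>2 * n\<close>, so the measure really drops.\<close>
  have decrease: "2 * n - (card I' + card J') < 2 * n - (card I + card J)"
    if "I' \<subseteq> {1..n}" "J' \<subseteq> {1..n}" "card I' + card J' = Suc (card I + card J)" for I' J'
    using card_mono[OF _ that(1)] card_mono[OF _ that(2)] that(3) by simp
  have extend_e: ?case
    if "j \<in> {1..n}" "j \<notin> I" "free_family (insert j I <+> J) (case_sum (e(j := w)) f)"
      "symplectic_relations (insert j I) J (e(j := w)) f" for j w
  proof -
    have "\<exists>e' f'. (\<forall>i\<in>insert j I. e' i = (e(j := w)) i) \<and> (\<forall>j\<in>J. f' j = f j) \<and>
        symplectic_basis n e' f'"
      by (rule less.hyps[OF decrease _ _ that(3,4)]) (use that I J fin in auto)
    then obtain e' f' where *: "\<forall>i\<in>insert j I. e' i = (e(j := w)) i" "\<forall>j\<in>J. f' j = f j"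
      and "symplectic_basis n e' f'"
      by blast
    moreover have "\<forall>i\<in>I. e' i = e i"
      using *(1) that(2) by auto
    ultimately show ?thesis
      by blast
  qed
  have extend_f: ?case
    if "i \<in> {1..n}" "i \<notin> J" "free_family (I <+> insert i J) (case_sum e (f(i := w)))"
      "symplectic_relations I (insert i J) e (f(i := w))" for i w
  proof -
    have "\<exists>e' f'. (\<forall>i\<in>I. e' i = e i) \<and> (\<forall>j\<in>insert i J. f' j = (f(i := w)) j) \<and>
        symplectic_basis n e' f'"
      by (rule less.hyps[OF decrease _ _ that(3,4)]) (use that I J fin in auto)
    then obtain e' f' where *: "\<forall>j\<in>insert i J. f' j = (f(i := w)) j" "\<forall>i\<in>I. e' i = e i"
      and "symplectic_basis n e' f'"
      by blast
    moreover have "\<forall>j\<in>J. f' j = f j"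
      using *(1) that(2) by auto
    ultimately show ?thesis
      by blast
  qed
  consider i where "i \<in> I" "i \<notin> J" | j where "j \<in> J" "j \<notin> I"
    | j where "I = J" "j \<in> {1..n}" "j \<notin> I" | "I = {1..n}" "J = {1..n}"
    using I J by blast
  then show ?case
  proof cases
    case (1 i)
    with I show ?thesis
      using ex_extend_f[OF B fin free rel 1] extend_f[of i] by blast
  next
    case (2 j)
    with J show ?thesis
      using ex_extend_e[OF B fin free rel 2] extend_e[of j] by blast
  next
    case (3 j)
    have "I \<subset> {1..n}"
      using 3 I by blast
    then have "card I < n"
      using psubset_card_mono[of "{1..n}" I] by simp
    then show ?thesis
      using ex_extend_orthogonal[OF rank fin(1), of e f j] free rel 3 extend_e[of j] by blast
  next
    case 4
    \<comment> \<open>All \<open>2 * n\<close> vectors are present and free, so only spanning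
      remains.\<close>
    have "span (case_sum e f ` ({1..n} <+> {1..n})) = UNIV"
      using rank free 4 by (intro span_eq_UNIV_of_free_family) (simp_all add: card_Plus mult_2)
    moreover have "case_sum e f ` ({1..n} <+> {1..n}) = e ` {1..n} \<union> f ` {1..n}"
      by (simp add: Plus_def image_Un image_image)
    ultimately have "symplectic_basis n e f"
      using free rel 4 by (simp add: symplectic_basis_def)
    then show ?thesis
      by blast
  qed
qed

end

theorem proposition3p5:
  fixes scale :: "gen_real \<Rightarrow> 'v::ab_group_add \<Rightarrow> 'v"
    and \<sigma> :: "'v \<Rightarrow> 'v \<Rightarrow> gen_real"
    and n :: nat
    and I J :: "nat set"
    and e f :: "nat \<Rightarrow> 'v"
  assumes "symplectic_module scale \<sigma>"
    and "module.free_of_rank scale (2 * n)"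
    and "I \<subseteq> {1..n}" and "J \<subseteq> {1..n}"
    and "module.free_family scale (I <+> J) (case_sum e f)"
    and "symplectic_module.symplectic_relations \<sigma> I J e f"
  shows "\<exists>e' f'. (\<forall>i\<in>I. e' i = e i) \<and> (\<forall>j\<in>J. f' j = f j) \<and>
           symplectic_module.symplectic_basis scale \<sigma> n e' f'"
  using symplectic_module.ex_symplectic_basis_extension[OF assms] .

end
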